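(* For every integer $n \geq 4$, the radio number of the $n$-gear graph $G_n$ is $rn(G_n) = 4n+2$.
   Context: All graphs are simple and connected; $d(u,v)$ is the graph distance and $\operatorname{diam}(G)$ the diameter. A radio labeling of $G$ is a one-to-one map $c: V(G) \to \mathbb{Z}_{+}$ (positive integers) such that $d(u,v) + |c(u)-c(v)| \geq \operatorname{diam}(G)+1$ for all distinct $u,v \in V(G)$. The span of $c$ is the maximum value of $c$; the radio number $rn(G)$ is the minimum span over all radio labelings of $G$. The $n$-gear $G_n$ is the graph consisting of a cycle on $2n$ vertices together with an additional center vertex adjacent to every other vertex of the cycle (equivalently, the wheel $W_n$ with a new vertex inserted on each edge of its rim); it has $2n+1$ vertices and $3n$ edges. *)

theory Defs
  imports "Graph_Theory.Graph_Theory"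
begin

text \<open>
  A simple graph is represented as a symmetric loop-free digraph without parallel arcs
  (locale \<^locale>\<open>pair_graph\<close>): each undirected edge contributes its two orientations.
  The notions below are meant for connected such graphs with at least one vertex.
\<close>

definition gdist :: "'a pair_pre_digraph \<Rightarrow> 'a \<Rightarrow> 'a \<Rightarrow> nat" where
  "gdist G u v = (LEAST k. \<exists>p. pre_digraph.awalk (with_proj G) u p v \<and> length p = k)"

definition gdiam :: "'a pair_pre_digraph \<Rightarrow> nat" where
  "gdiam G = Max {gdist G u v | u v. u \<in> pverts G \<and> v \<in> pverts G}"

definition radio_labeling :: "'a pair_pre_digraph \<Rightarrow> ('a \<Rightarrow> nat) \<Rightarrow> bool" where
  "radio_labeling G c \<longleftrightarrow>
     inj_on c (pverts G) \<and> (\<forall>v \<in> pverts G. c v > 0) \<and>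
     (\<forall>u \<in> pverts G. \<forall>v \<in> pverts G. u \<noteq> v \<longrightarrow>
        int (gdist G u v) + \<bar>int (c u) - int (c v)\<bar> \<ge> int (gdiam G) + 1)"

definition label_span :: "'a pair_pre_digraph \<Rightarrow> ('a \<Rightarrow> nat) \<Rightarrow> nat" where
  "label_span G c = Max (c ` pverts G)"

definition radio_number :: "'a pair_pre_digraph \<Rightarrow> nat" where
  "radio_number G = (LEAST s. \<exists>c. radio_labeling G c \<and> label_span G c = s)"

datatype gear_vertex = Center | Rim nat

definition gear_arcs :: "nat \<Rightarrow> gear_vertex rel" where
  "gear_arcs n = {(Rim i, Rim ((i + 1) mod (2 * n))) | i. i < 2 * n}
               \<union> {(Center, Rim i) | i. i < 2 * n \<and> even i}"

text \<open>Only for \<open>n \<ge> 2\<close> is the rim of length \<open>2 * n\<close> a genuine cycle.\<close>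

definition gear :: "nat \<Rightarrow> gear_vertex pair_pre_digraph" where
  "gear n = \<lparr>pverts = insert Center (Rim ` {..<2 * n}), parcs = gear_arcs n \<union> (gear_arcs n)\<inverse>\<rparr>"

lemma gdist_eq_mu:
  assumes "pair_wf_digraph G" and "u \<rightarrow>\<^sup>*\<^bsub>with_proj G\<^esub> v"
  shows "wf_digraph.\<mu> (with_proj G) (\<lambda>_. 1) u v = ereal (real (gdist G u v))"
proof -
  interpret pair_wf_digraph G by fact
  let ?P = "\<lambda>k. \<exists>p. pre_digraph.awalk (with_proj G) u p v \<and> length p = k"
  have cost: "awalk_cost (\<lambda>_. 1) p = real (length p)" for p :: "('a \<times> 'a) list"
    by (induction p) auto
  obtain q where "awalk u q v"
    using assms(2) reachable_awalk by auto
  then have "?P (length q)" by blast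
  then have "?P (gdist G u v)"
    unfolding gdist_def by (rule LeastI)
  then obtain p where p: "awalk u p v" "length p = gdist G u v" by blast
  have le: "gdist G u v \<le> length r" if "awalk u r v" for r
    unfolding gdist_def by (rule Least_le) (use that in blast)
  show ?thesis
    unfolding \<mu>_def
  proof (rule antisym)
    show "(INF p\<in>{p. awalk u p v}. ereal (awalk_cost (\<lambda>_. 1) p)) \<le> ereal (real (gdist G u v))"
      using p by (intro INF_lower2[of p]) (auto simp: cost)
    show "ereal (real (gdist G u v)) \<le> (INF p\<in>{p. awalk u p v}. ereal (awalk_cost (\<lambda>_. 1) p))"
      using le by (intro INF_greatest) (auto simp: cost)
  qed
qed

lemma finite_gear_arcs: "finite (gear_arcs n)"
proof -
  have "gear_arcs n = (\<lambda>i. (Rim i, Rim ((i + 1) mod (2 * n)))) ` {..<2 * n}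
      \<union> (\<lambda>i. (Center, Rim i)) ` {i. i < 2 * n \<and> even i}"
    unfolding gear_arcs_def by auto
  then show ?thesis by simp
qed

lemma pair_graph_gear:
  assumes "n \<ge> 2"
  shows "pair_graph (gear n)"
proof
  show "fst e \<in> pverts (gear n)" "snd e \<in> pverts (gear n)" if "e \<in> parcs (gear n)" for e
    using that assms by (auto simp: gear_def gear_arcs_def)
  show "finite (pverts (gear n))" by (simp add: gear_def)
  show "finite (parcs (gear n))" by (simp add: gear_def finite_gear_arcs)
  show "fst e \<noteq> snd e" if "e \<in> parcs (gear n)" for e
    using that assms by (auto simp: gear_def gear_arcs_def mod_Suc split: if_splits)
  show "symmetric (with_proj (gear n))"
    by (auto simp: symmetric_def gear_def intro!: symI)
qed

lemma card_pverts_gear: "card (pverts (gear n)) = 2 * n + 1"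
  by (subst gear_def) (simp add: card_insert_if card_image inj_on_def image_iff)

lemma card_parcs_gear:
  assumes "n \<ge> 2"
  shows "card (parcs (gear n)) = 2 * (3 * n)"
proof -
  let ?A = "(\<lambda>i. (Rim i, Rim ((i + 1) mod (2 * n)))) ` {..<2 * n}"
  let ?B = "(\<lambda>i. (Center, Rim (2 * i))) ` {..<n}"
  have eq: "gear_arcs n = ?A \<union> ?B"
    unfolding gear_arcs_def by (auto elim!: evenE)
  have "card (gear_arcs n) = card ?A + card ?B"
    unfolding eq by (rule card_Un_disjoint) auto
  also have "card ?A = 2 * n" by (subst card_image) (auto simp: inj_on_def)
  also have "card ?B = n" by (subst card_image) (auto simp: inj_on_def)
  finally have c: "card (gear_arcs n) = 3 * n" by simp
  have "gear_arcs n \<inter> (gear_arcs n)\<inverse> = {}"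
    using assms by (auto simp: gear_arcs_def mod_Suc split: if_splits)
  then have "card (gear_arcs n \<union> (gear_arcs n)\<inverse>) = card (gear_arcs n) + card ((gear_arcs n)\<inverse>)"
    by (intro card_Un_disjoint) (auto simp: finite_gear_arcs)
  then show ?thesis by (simp add: gear_def c)
qed

lemma connected_gear:
  assumes "n \<ge> 2"
  shows "connected (with_proj (gear n))"
proof -
  interpret pair_graph "gear n" using assms by (rule pair_graph_gear)
  have sp: "(Center, Rim i) \<in> parcs (gear n)" if "i < 2 * n" "even i" for i
    using that by (auto simp: gear_def gear_arcs_def)
  have ctr: "Center \<in> pverts (gear n)" by (simp add: gear_def)
  have r: "Center \<rightarrow>\<^sup>*\<^bsub>with_proj (gear n)\<^esub> Rim i" if i: "i < 2 * n" for i
  proof -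
    have "(Center, Rim i) \<in> (parcs (gear n))\<^sup>*"
    proof (cases "even i")
      case True
      then show ?thesis using sp[OF i] by blast
    next
      case False
      then obtain j where j: "i = Suc j" "even j" by (cases i) auto
      have "(Rim j, Rim i) \<in> parcs (gear n)"
        using i j by (auto simp: gear_def gear_arcs_def)
      moreover have "(Center, Rim j) \<in> parcs (gear n)" using sp i j by simp
      ultimately show ?thesis by (meson r_into_rtrancl rtrancl_into_rtrancl)
    qed
    then show ?thesis using reachable_conv'[OF ctr] by simp
  qed
  have c: "Center \<rightarrow>\<^sup>*\<^bsub>with_proj (gear n)\<^esub> v" if "v \<in> pverts (gear n)" for v
  proof -
    have "v = Center \<or> (\<exists>i < 2 * n. v = Rim i)"
      using that by (auto simp: gear_def)
    then show ?thesis using r reachable_conv'[OF ctr, of Center] by auto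
  qed
  have "u \<rightarrow>\<^sup>*\<^bsub>with_proj (gear n)\<^esub> v" if "u \<in> pverts (gear n)" "v \<in> pverts (gear n)" for u v
    using reachable_trans[OF symmetric_reachable[OF sym_arcs c] c] that by simp
  then have "u \<rightarrow>\<^sup>*\<^bsub>mk_symmetric (with_proj (gear n))\<^esub> v"
    if "u \<in> pverts (gear n)" "v \<in> pverts (gear n)" for u v
    using that by (intro reachable_mk_symmetricI) simp
  then show ?thesis
    using ctr unfolding connected_def strongly_connected_def by auto
qed

end

theory Submission
  imports Defs
begin

text \<open>
  Let \<open>l v\<close> be the distance of \<open>v\<close> to the center, so that \<open>d u v \<le> l u + l v\<close>. Listing the
  vertices by increasing label, consecutive labels differ by at least \<open>5 - l u - l v\<close>; summing up,
  every level is counted twice except those of the two extreme vertices, whose sum is at least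
  \<open>1\<close>. As the levels add up to \<open>3 * n\<close>, the span is at least \<open>1 + 5 * 2 * n - (6 * n - 1)\<close>.
  This is attained by alternating spokeless and spoked rim vertices, with gaps of \<open>2\<close>, in such a
  way that consecutive ones are not adjacent; a rotation by three spokes achieves this as soon as
  \<open>n \<ge> 4\<close>.
\<close>

section \<open>Distances from walks and two-colourings; sums of label gaps\<close>

lemma gdist_le_length:
  assumes "pre_digraph.awalk (with_proj G) u p v"
  shows "gdist G u v \<le> length p"
  unfolding gdist_def by (rule Least_le) (use assms in blast)

lemma gdist_geI:
  assumes "pre_digraph.awalk (with_proj G) u q v"
    and "\<And>p. pre_digraph.awalk (with_proj G) u p v \<Longrightarrow> k \<le> length p"
  shows "k \<le> gdist G u v"
  unfolding gdist_def by (rule LeastI2[where a = "length q"]) (use assms in auto)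

text \<open>For a bipartite graph with colouring \<open>col\<close>, this bounds the distance from \<open>u\<close> from below;
  the bound is exact up to distance \<open>3\<close>.\<close>

definition bipartite_lower :: "'a rel \<Rightarrow> ('a \<Rightarrow> bool) \<Rightarrow> 'a \<Rightarrow> 'a \<Rightarrow> nat" where
  "bipartite_lower A col u v =
     (if v = u then 0 else if (u, v) \<in> A then 1
      else if col v \<noteq> col u then 3
      else if \<exists>w. (u, w) \<in> A \<and> (w, v) \<in> A then 2 else 4)"

text \<open>Arcs flip the colour and with it the parity of the bound, so only jumps from 0 to 3 and
  from 1 to 4 must be excluded: out-neighbours of \<open>u\<close> have value 1, and if
  \<open>x\<close> is one of them, it serves as the midpoint \<open>w\<close> for
  \<open>y\<close>.\<close>

lemma bipartite_lower_le_Suc: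
  assumes "\<And>x y. (x, y) \<in> A \<Longrightarrow> col x \<noteq> col y" and "(x, y) \<in> A"
  shows "bipartite_lower A col u y \<le> Suc (bipartite_lower A col u x)"
  using assms(1)[of x y] assms(1)[of u x] assms(1)[of u y] assms(2)
  unfolding bipartite_lower_def by auto

lemma (in pair_wf_digraph) bipartite_lower_le_length_awalk:
  assumes "\<And>x y. (x, y) \<in> parcs G \<Longrightarrow> col x \<noteq> col y" and "awalk w p v"
  shows "bipartite_lower (parcs G) col u v \<le> bipartite_lower (parcs G) col u w + length p"
  using assms(2)
proof (induction p arbitrary: w)
  case Nil
  then show ?case by (auto simp: awalk_Nil_iff)
next
  case (Cons e p)
  then obtain x where "(w, x) \<in> parcs G" "awalk x p v"
    by (cases e) (auto simp: awalk_Cons_iff)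
  with Cons.IH[of x] bipartite_lower_le_Suc[of "parcs G" col w x u] assms(1)
  show ?case by fastforce
qed

lemma (in pair_wf_digraph) bipartite_lower_le_gdist:
  assumes "\<And>x y. (x, y) \<in> parcs G \<Longrightarrow> col x \<noteq> col y" and "awalk u q v"
  shows "bipartite_lower (parcs G) col u v \<le> gdist G u v"
  using assms(2)
proof (rule gdist_geI)
  show "bipartite_lower (parcs G) col u v \<le> length p" if "awalk u p v" for p
    using bipartite_lower_le_length_awalk[of col u p v u] assms(1) that
    by (simp add: bipartite_lower_def)
qed

text \<open>Elements are added by increasing label: \<open>a\<close> stays, the new element replaces
  \<open>b\<close>, and the gap between the old \<open>b\<close> and the new one is added. A
  singleton forces \<open>a = b\<close>, hence the guard on \<open>card S\<close>.\<close>

lemma label_gap_sum: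
  fixes c :: "'a \<Rightarrow> nat" and l :: "'a \<Rightarrow> int"
  assumes "finite S" and "S \<noteq> {}" and "inj_on c S"
    and "\<And>u v. u \<in> S \<Longrightarrow> v \<in> S \<Longrightarrow> c u < c v \<Longrightarrow> int (c v) - int (c u) \<ge> k - l u - l v"
  shows "\<exists>a \<in> S. \<exists>b \<in> S. (card S \<ge> 2 \<longrightarrow> a \<noteq> b) \<and>
    int (c b) - int (c a) + 2 * sum l S \<ge> k * (int (card S) - 1) + l a + l b"
  using assms
proof (induction S rule: finite_ranking_induct[where f = c])
  case empty
  then show ?case by simp
next
  case (insert x S)
  show ?case
  proof (cases "S = {}")
    case True
    then show ?thesis by simp
  next
    case False
    obtain a b where ab: "a \<in> S" "b \<in> S"
      "int (c b) - int (c a) + 2 * sum l S \<ge> k * (int (card S) - 1) + l a + l b"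
      using insert.IH[OF False inj_on_subset[OF insert.prems(2)]] insert.prems(3) by blast
    \<comment> \<open>The induction rule does not make \<open>x\<close> fresh and orders labels only
      weakly; injectivity gives strictness once \<open>x\<close> is new.\<close>
    show ?thesis
    proof (cases "x \<in> S")
      case True
      then show ?thesis using insert.IH insert.prems False by (simp add: insert_absorb)
    next
      case x: False
      have "c b < c x"
        using insert.hyps(2)[OF ab(2)] insert.prems(2) ab(2) x
        by (metis inj_on_contraD insertCI le_neq_implies_less)
      then have "int (c x) - int (c b) \<ge> k - l b - l x"
        using insert.prems(3)[of b x] ab by simp
      then have "int (c x) - int (c a) + 2 * sum l (insert x S)
          \<ge> k * (int (card (insert x S)) - 1) + l a + l x"
        using ab(3) x insert.hyps(1) by (simp add: algebra_simps)
      moreover have "a \<noteq> x" using ab x by blast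
      ultimately show ?thesis using ab by blast
    qed
  qed
qed

section \<open>Levels, distances and diameter of the gear\<close>

fun gear_level :: "gear_vertex \<Rightarrow> nat" where
  "gear_level Center = 0"
| "gear_level (Rim i) = (if even i then 1 else 2)"

text \<open>The bipartition of the gear: every arc joins a spoked rim vertex to the centre or to a
  spokeless one.\<close>

fun gear_colour :: "gear_vertex \<Rightarrow> bool" where
  "gear_colour Center = True"
| "gear_colour (Rim i) = odd i"

lemma pverts_gear: "pverts (gear n) = insert Center (Rim ` {..<2 * n})"
  by (simp add: gear_def)

lemma gear_level_le_2: "gear_level v \<le> 2"
  by (cases v) auto

lemma sum_gear_level: "(\<Sum>v \<in> pverts (gear n). int (gear_level v)) = 3 * int n"
proof -
  have "(\<Sum>i<2 * n. int (gear_level (Rim i))) = 3 * int n"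
    by (induction n) auto
  then show ?thesis
    by (subst pverts_gear) (simp add: sum.reindex inj_on_def image_iff del: gear_level.simps(2))
qed

lemma arc_gear_iff:
  assumes "n \<ge> 2"
  shows "(Center, Rim i) \<in> parcs (gear n) \<longleftrightarrow> i < 2 * n \<and> even i"
    and "(Rim i, Center) \<in> parcs (gear n) \<longleftrightarrow> i < 2 * n \<and> even i"
    and "(Center, Center) \<notin> parcs (gear n)"
    and "(Rim i, Rim j) \<in> parcs (gear n) \<longleftrightarrow> i < 2 * n \<and> j < 2 * n \<and>
      (j = Suc i \<or> i = Suc j \<or> i = 0 \<and> Suc j = 2 * n \<or> j = 0 \<and> Suc i = 2 * n)"
  using assms by (auto simp: gear_def gear_arcs_def mod_Suc)

lemma arc_gear_sym: "(u, v) \<in> parcs (gear n) \<Longrightarrow> (v, u) \<in> parcs (gear n)"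
  by (auto simp: gear_def)

lemma arc_gear_colour:
  assumes "n \<ge> 2" and "(u, v) \<in> parcs (gear n)"
  shows "gear_colour u \<noteq> gear_colour v"
proof -
  \<comment> \<open>The arc closing the rim changes colour because the rim has even length.\<close>
  have "even (2 * n)" by simp
  then have odd: "odd j" if "Suc j = 2 * n" for j using that by (metis even_Suc)
  show ?thesis
    using assms odd by (cases u; cases v) (auto simp: arc_gear_iff)
qed

lemma awalk_gear_Center:
  assumes "n \<ge> 2" and "v \<in> pverts (gear n)"
  obtains p q where
    "pre_digraph.awalk (with_proj (gear n)) Center p v" "length p = gear_level v"
    "pre_digraph.awalk (with_proj (gear n)) v q Center" "length q = gear_level v"
proof -
  interpret pair_graph "gear n" using assms by (intro pair_graph_gear)
  have ctr: "Center \<in> pverts (gear n)" by (simp add: gear_def)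
  \<comment> \<open>A spokeless vertex is reached through its predecessor on the rim, so no
    wraparound occurs.\<close>
  consider "v = Center" | i where "v = Rim i" "i < 2 * n" "even i"
    | i where "v = Rim (Suc i)" "Suc i < 2 * n" "even i"
  proof -
    assume *: "v = Center \<Longrightarrow> thesis" "\<And>i. v = Rim i \<Longrightarrow> i < 2 * n \<Longrightarrow> even i \<Longrightarrow> thesis"
      "\<And>i. v = Rim (Suc i) \<Longrightarrow> Suc i < 2 * n \<Longrightarrow> even i \<Longrightarrow> thesis"
    show thesis
    proof (cases v)
      case Center
      then show ?thesis using * by blast
    next
      case (Rim i)
      then have "i < 2 * n" using assms(2) by (auto simp: gear_def)
      with Rim * show ?thesis by (cases i) auto
    qed
  qed
  then show thesis
  proof cases
    case 1
    show ?thesis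
      by (rule that[of "[]" "[]"]) (use 1 ctr in \<open>auto simp: awalk_Nil_iff\<close>)
  next
    case 2
    show ?thesis
      by (rule that[of "[(Center, v)]" "[(v, Center)]"])
        (use 2 assms ctr in \<open>auto simp: awalk_Nil_iff awalk_Cons_iff arc_gear_iff pverts_gear\<close>)
  next
    case 3
    show ?thesis
      by (rule that[of "[(Center, Rim i), (Rim i, v)]" "[(v, Rim i), (Rim i, Center)]"])
        (use 3 assms ctr in \<open>auto simp: awalk_Nil_iff awalk_Cons_iff arc_gear_iff pverts_gear\<close>)
  qed
qed

lemma awalk_gear_via_Center:
  assumes "n \<ge> 2" and "u \<in> pverts (gear n)" and "v \<in> pverts (gear n)"
  obtains p where "pre_digraph.awalk (with_proj (gear n)) u p v"
    "length p = gear_level u + gear_level v"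
proof -
  interpret pair_graph "gear n" using assms by (intro pair_graph_gear)
  obtain p where "awalk u p Center" "length p = gear_level u"
    using awalk_gear_Center[OF assms(1,2)] by metis
  moreover obtain q where "awalk Center q v" "length q = gear_level v"
    using awalk_gear_Center[OF assms(1,3)] by metis
  ultimately show thesis
    using that[of "p @ q"] by (auto intro: awalk_appendI)
qed

lemma gdist_gear_le:
  assumes "n \<ge> 2" and "u \<in> pverts (gear n)" and "v \<in> pverts (gear n)"
  shows "gdist (gear n) u v \<le> gear_level u + gear_level v"
  using awalk_gear_via_Center[OF assms] gdist_le_length by metis

lemma gdist_gear_ge:
  assumes "n \<ge> 2" and "u \<in> pverts (gear n)" and "v \<in> pverts (gear n)"
  shows "bipartite_lower (parcs (gear n)) gear_colour u v \<le> gdist (gear n) u v"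
proof -
  interpret pair_graph "gear n" using assms by (intro pair_graph_gear)
  show ?thesis
    using awalk_gear_via_Center[OF assms] bipartite_lower_le_gdist arc_gear_colour[OF assms(1)]
    by metis
qed

lemma gdiam_gear:
  assumes "n \<ge> 4"
  shows "gdiam (gear n) = 4"
  unfolding gdiam_def
proof (rule Max_eqI)
  have "{gdist (gear n) u v | u v. u \<in> pverts (gear n) \<and> v \<in> pverts (gear n)}
      = (\<lambda>(u, v). gdist (gear n) u v) ` (pverts (gear n) \<times> pverts (gear n))"
    by auto
  then show "finite {gdist (gear n) u v | u v. u \<in> pverts (gear n) \<and> v \<in> pverts (gear n)}"
    by (simp add: pverts_gear)
  have le: "gdist (gear n) u v \<le> 4" if "u \<in> pverts (gear n)" "v \<in> pverts (gear n)" for u v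
    using gdist_gear_le[OF _ that] gear_level_le_2[of u] gear_level_le_2[of v] assms by linarith
  then show "\<And>k. k \<in> {gdist (gear n) u v | u v. u \<in> pverts (gear n) \<and> v \<in> pverts (gear n)} \<Longrightarrow> k \<le> 4"
    by blast
  \<comment> \<open>The neighbours are \<open>Rim 0\<close>, \<open>Rim 2\<close> and
    \<open>Rim 4\<close>, \<open>Rim 6\<close>; \<open>n \<ge> 4\<close> keeps \<open>Rim 6\<close>
    distinct from \<open>Rim 0\<close>.\<close>
  have mem: "Rim 1 \<in> pverts (gear n)" "Rim 5 \<in> pverts (gear n)"
    using assms by (auto simp: pverts_gear)
  have "\<not> ((Rim 1, w) \<in> parcs (gear n) \<and> (w, Rim 5) \<in> parcs (gear n))" for w
    using assms by (cases w) (auto simp: arc_gear_iff)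
  then have "bipartite_lower (parcs (gear n)) gear_colour (Rim 1) (Rim 5) = 4"
    using assms by (auto simp: bipartite_lower_def arc_gear_iff)
  then have "gdist (gear n) (Rim 1) (Rim 5) = 4"
    using gdist_gear_ge[OF _ mem] le[OF mem] assms by simp
  then show "4 \<in> {gdist (gear n) u v | u v. u \<in> pverts (gear n) \<and> v \<in> pverts (gear n)}"
    using mem by force
qed

section \<open>Lower bound for the span\<close>

lemma label_span_gear_ge:
  assumes "n \<ge> 4" and "radio_labeling (gear n) c"
  shows "4 * n + 2 \<le> label_span (gear n) c"
proof -
  let ?V = "pverts (gear n)"
  have fin: "finite ?V" and ne: "?V \<noteq> {}" by (simp_all add: pverts_gear)
  have inj: "inj_on c ?V" and pos: "\<And>v. v \<in> ?V \<Longrightarrow> 0 < c v"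
    and gap: "\<And>u v. u \<in> ?V \<Longrightarrow> v \<in> ?V \<Longrightarrow> u \<noteq> v \<Longrightarrow>
      int (gdist (gear n) u v) + \<bar>int (c u) - int (c v)\<bar> \<ge> 5"
    using assms by (auto simp: radio_labeling_def gdiam_gear)
  have "int (c v) - int (c u) \<ge> 5 - int (gear_level u) - int (gear_level v)"
    if "u \<in> ?V" "v \<in> ?V" "c u < c v" for u v
  proof -
    have "u \<noteq> v" using that by auto
    from gap[OF that(1,2) this] gdist_gear_le[of n u v] that assms(1) show ?thesis by simp
  qed
  from label_gap_sum[OF fin ne inj, of 5 "\<lambda>v. int (gear_level v)", OF this]
  obtain a b where ab: "a \<in> ?V" "b \<in> ?V" "a \<noteq> b"
    "int (c b) - int (c a) + 2 * (\<Sum>v \<in> ?V. int (gear_level v))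
      \<ge> 5 * (int (card ?V) - 1) + int (gear_level a) + int (gear_level b)"
    using assms(1) by (auto simp: card_pverts_gear)
  \<comment> \<open>Only the centre has level 0, and \<open>a \<noteq> b\<close>.\<close>
  have "gear_level a + gear_level b \<ge> 1"
    using ab(3) by (cases a; cases b) auto
  moreover have "c a \<ge> 1" using pos[OF ab(1)] by simp
  ultimately have "4 * n + 2 \<le> c b"
    using ab(4) by (simp add: sum_gear_level card_pverts_gear)
  also have "c b \<le> label_span (gear n) c"
    unfolding label_span_def using fin ab(2) by simp
  finally show ?thesis .
qed

section \<open>A labeling of span \<open>4 * n + 2\<close>\<close>

text \<open>For even \<open>i\<close> this is \<open>4 * p + 6\<close> where \<open>p = (i div 2 - 3) mod n\<close>, which lies between the
  labels of \<open>Rim (2 * p + 1)\<close> and \<open>Rim (2 * p + 3)\<close>.\<close>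

fun gear_label :: "nat \<Rightarrow> gear_vertex \<Rightarrow> nat" where
  "gear_label n Center = 1"
| "gear_label n (Rim i) =
     (if odd i then 2 * i + 2 else if i < 6 then 2 * i + 4 * n - 6 else 2 * i - 6)"

text \<open>Vertices of equal colour have distance at least 2 and need a gap of 3; adjacent ones
  need 4; the remaining pairs have distance at least 3 and need 2.\<close>

lemma gear_label_gap:
  assumes "n \<ge> 4" and "u \<in> pverts (gear n)" and "v \<in> pverts (gear n)" and "u \<noteq> v"
  shows "int (bipartite_lower (parcs (gear n)) gear_colour u v)
    + \<bar>int (gear_label n u) - int (gear_label n v)\<bar> \<ge> 5"
proof -
  let ?A = "parcs (gear n)" and ?c = "\<lambda>v. int (gear_label n v)"
  let ?L = "int (bipartite_lower ?A gear_colour u v)"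
  have n: "n \<ge> 2" using assms(1) by simp
  have L1: "?L \<ge> 1" and L2: "(u, v) \<notin> ?A \<Longrightarrow> ?L \<ge> 2"
    and L3: "(u, v) \<notin> ?A \<Longrightarrow> gear_colour u \<noteq> gear_colour v \<Longrightarrow> ?L \<ge> 3"
    using assms(4) by (auto simp: bipartite_lower_def)
  \<comment> \<open>Adjacent rim labels differ by 6, 10, \<open>4 * n - 10\<close> or
    \<open>4 * n - 6\<close>; here \<open>n \<ge> 4\<close> matters. The centre has label 1 and
    spoked labels are at least 6.\<close>
  have far: "\<bar>?c x - ?c y\<bar> \<ge> 4" if xy: "(x, y) \<in> ?A" "gear_colour x" for x y
  proof (cases x)
    case Center
    with xy n assms(1) show ?thesis by (cases y) (auto simp: arc_gear_iff)
  next
    case (Rim i)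
    then obtain k where k: "i = 2 * k + 1" using xy(2) by (auto elim: oddE)
    obtain j where y: "y = Rim j" using xy Rim k n by (cases y) (auto simp: arc_gear_iff)
    have "even j" using arc_gear_colour[OF n xy(1)] xy(2) y by simp
    then obtain m where m: "j = 2 * m" by (auto elim: evenE)
    have "k < n" "m < n" "m = k \<or> m = Suc k \<or> m = 0 \<and> Suc k = n"
      using xy(1) n by (auto simp: Rim y k m arc_gear_iff)
    then show ?thesis
      using assms(1) by (auto simp: Rim y k m)
  qed
  \<comment> \<open>On the rim, spokeless labels are 0 and spoked ones 2 modulo 4.\<close>
  have near: "\<bar>?c x - ?c y\<bar> \<ge> 2"
    if xy: "x \<in> pverts (gear n)" "y \<in> pverts (gear n)" "gear_colour x" "\<not> gear_colour y" for x y
  proof -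
    obtain m where y: "y = Rim (2 * m)" "m < n"
      using xy(2,4) by (cases y) (auto simp: pverts_gear elim: evenE)
    show ?thesis
    proof (cases x)
      case Center
      then show ?thesis using y assms(1) by auto
    next
      case (Rim i)
      then obtain k where "i = 2 * k + 1" using xy(3) by (auto elim: oddE)
      then have "?c x = 4 * int k + 4" using Rim by simp
      moreover have "\<exists>p. ?c y = 4 * p + 2"
        using y assms(1) by (auto intro: exI[of _ "int m + int n - 2"] exI[of _ "int m - 2"])
      ultimately show ?thesis by presburger
    qed
  qed
  \<comment> \<open>Distinct rim labels of one colour differ by a multiple of 4; the centre and
    \<open>Rim 1\<close>, labelled 1 and 4, give exactly 3.\<close>
  have same: "\<bar>?c u - ?c v\<bar> \<ge> 3" if "gear_colour u = gear_colour v"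
  proof (cases "u = Center \<or> v = Center")
    case True
    then show ?thesis using assms(4) that by (cases u; cases v) (auto elim!: oddE)
  next
    case False
    then obtain i j where ij: "u = Rim i" "v = Rim j" by (metis gear_vertex.exhaust)
    show ?thesis
    proof (cases "odd i")
      case True
      then have "odd j" using that ij by simp
      with True obtain k m where "i = 2 * k + 1" "j = 2 * m + 1" by (metis oddE)
      then show ?thesis using assms(4) ij by auto
    next
      case False
      then have "even j" using that ij by simp
      with False obtain k m where "i = 2 * k" "j = 2 * m" by (metis evenE)
      then show ?thesis using assms ij by (auto simp: pverts_gear)
    qed
  qed
  show ?thesis
  proof (cases "gear_colour u = gear_colour v")
    case True
    then have "(u, v) \<notin> ?A" using arc_gear_colour[OF n] by blast
    with L2 same[OF True] show ?thesis by simp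
  next
    case colour: False
    show ?thesis
    proof (cases "(u, v) \<in> ?A")
      case True
      then have "\<bar>?c u - ?c v\<bar> \<ge> 4"
        using far[of u v] far[of v u] arc_gear_sym colour abs_minus_commute[of "?c u" "?c v"]
        by auto
      with L1 show ?thesis by simp
    next
      case False
      have "\<bar>?c u - ?c v\<bar> \<ge> 2"
        using near[of u v] near[of v u] assms(2,3) colour abs_minus_commute[of "?c u" "?c v"]
        by auto
      with L3[OF False colour] show ?thesis by simp
    qed
  qed
qed

lemma radio_labeling_gear_label:
  assumes "n \<ge> 4"
  shows "radio_labeling (gear n) (gear_label n)"
proof -
  have gap: "int (gdist (gear n) u v) + \<bar>int (gear_label n u) - int (gear_label n v)\<bar> \<ge> 5"
    if "u \<in> pverts (gear n)" "v \<in> pverts (gear n)" "u \<noteq> v" for u v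
    using gear_label_gap[OF assms that] gdist_gear_ge[OF _ that(1,2)] assms by linarith
  \<comment> \<open>Equal labels would force a distance of at least 5, above the diameter.\<close>
  have "inj_on (gear_label n) (pverts (gear n))"
  proof (rule inj_onI, rule ccontr)
    fix u v
    assume uv: "u \<in> pverts (gear n)" "v \<in> pverts (gear n)"
      "gear_label n u = gear_label n v" "u \<noteq> v"
    have "gdist (gear n) u v \<le> 4"
      using gdist_gear_le[OF _ uv(1,2)] gear_level_le_2[of u] gear_level_le_2[of v] assms
      by linarith
    with gap[OF uv(1,2,4)] uv(3) show False by simp
  qed
  moreover have "gear_label n v > 0" for v
    using assms by (cases v) auto
  ultimately show ?thesis
    using gap by (simp add: radio_labeling_def gdiam_gear[OF assms])
qed

lemma label_span_gear_label:
  assumes "n \<ge> 4"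
  shows "label_span (gear n) (gear_label n) = 4 * n + 2"
proof -
  have "gear_label n v \<le> 4 * n + 2" if "v \<in> pverts (gear n)" for v
    using that assms by (cases v) (auto simp: pverts_gear elim!: evenE)
  \<comment> \<open>\<open>Rim 4\<close> is the last of the shifted spoked vertices; spokeless
    labels end at \<open>4 * n\<close>.\<close>
  moreover have "gear_label n (Rim 4) = 4 * n + 2" "Rim 4 \<in> pverts (gear n)"
    using assms by (auto simp: pverts_gear)
  ultimately show ?thesis
    unfolding label_span_def by (intro Max_eqI) (auto simp: pverts_gear intro!: rev_image_eqI)
qed

theorem theorem2p3:
  fixes n :: nat
  assumes "n \<ge> 4"
  shows "radio_number (gear n) = 4 * n + 2"
  unfolding radio_number_def
  using radio_labeling_gear_label[OF assms] label_span_gear_label[OF assms]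
    label_span_gear_ge[OF assms]
  by (intro Least_equality) auto

end
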